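(* For every integer $d\ge1$ and every $d$-SMNBP $Z$, there is a $d$-SMNBP $Z'$ with yardsticks that represents the same function as $Z$ (same variables and same set of satisfying assignments) and has at most $3|Z|$ edges.
   Context: A nondeterministic branching program (NBP) $Z$ is a directed acyclic graph, multiple edges allowed, with one source and one sink, some of whose edges are labelled with literals; $Var(Z)$ is the set of variables labelling edges. A path is consistent if it does not contain both a variable and its negation among its labels; $A(P)$ is the set of labels of $P$. A satisfying assignment of $Z$ is an assignment $S$ to $Var(Z)$ such that some consistent source-sink path $P$ has $A(P)\subseteq S$. $|Z|$ is the number of edges. $Z$ is monotone if no edge is labelled with a negative literal. A path is read-once if no two of its edges are labelled with the same variable. A $d$-SMNBP is a monotone NBP in which along every path each variable labels at most $d$ edges, and every source-sink path can be partitioned into at most $d$ edge-disjoint consecutive read-once subpaths. A $d$-SMNBP $Z$ has yardsticks if every source-sink path $P$ contains vertices $u_1,\dots,u_{a+1}$, $a\le d$, occurring on $P$ in this order, with $u_1$ the source and $u_{a+1}$ the sink, such that for every $1\le i\le a$, every path of $Z$ from $u_i$ to $u_{i+1}$ is read-once. *)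

theory Defs
  imports "Graph_Theory.Graph_Theory" "HOL-Library.Sublist"
begin

datatype 'x lit = Pos (lit_var: 'x) | Neg (lit_var: 'x)

text \<open>The label of an edge is \<open>None\<close> if the edge is unlabelled. Labels are only ever consulted
  on the arcs of the graph.\<close>

record ('v, 'e, 'x) branching_program =
  graph :: "('v, 'e) pre_digraph"
  label :: "'e \<Rightarrow> 'x lit option"

definition edge_var :: "('v, 'e, 'x) branching_program \<Rightarrow> 'e \<Rightarrow> 'x option" where
  "edge_var Z e = map_option lit_var (label Z e)"

definition is_source :: "('v, 'e, 'x) branching_program \<Rightarrow> 'v \<Rightarrow> bool" where
  "is_source Z v \<longleftrightarrow> v \<in> verts (graph Z) \<and> in_arcs (graph Z) v = {}"

definition is_sink :: "('v, 'e, 'x) branching_program \<Rightarrow> 'v \<Rightarrow> bool" where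
  "is_sink Z v \<longleftrightarrow> v \<in> verts (graph Z) \<and> out_arcs (graph Z) v = {}"

definition nbp :: "('v, 'e, 'x) branching_program \<Rightarrow> bool" where
  "nbp Z \<longleftrightarrow> fin_digraph (graph Z) \<and> (\<nexists>p. pre_digraph.cycle (graph Z) p) \<and>
     (\<exists>!v. is_source Z v) \<and> (\<exists>!v. is_sink Z v)"

definition source :: "('v, 'e, 'x) branching_program \<Rightarrow> 'v" where
  "source Z = (THE v. is_source Z v)"

definition sink :: "('v, 'e, 'x) branching_program \<Rightarrow> 'v" where
  "sink Z = (THE v. is_sink Z v)"

definition num_edges :: "('v, 'e, 'x) branching_program \<Rightarrow> nat" where
  "num_edges Z = card (arcs (graph Z))"

definition vars :: "('v, 'e, 'x) branching_program \<Rightarrow> 'x set" where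
  "vars Z = {x. \<exists>e \<in> arcs (graph Z). edge_var Z e = Some x}"

abbreviation path :: "('v, 'e, 'x) branching_program \<Rightarrow> 'v \<Rightarrow> 'e list \<Rightarrow> 'v \<Rightarrow> bool" where
  "path Z \<equiv> pre_digraph.apath (graph Z)"

abbreviation source_sink_path :: "('v, 'e, 'x) branching_program \<Rightarrow> 'e list \<Rightarrow> bool" where
  "source_sink_path Z p \<equiv> path Z (source Z) p (sink Z)"

definition path_labels :: "('v, 'e, 'x) branching_program \<Rightarrow> 'e list \<Rightarrow> 'x lit set" where
  "path_labels Z p = {l. \<exists>e \<in> set p. label Z e = Some l}"

definition consistent :: "'x lit set \<Rightarrow> bool" where
  "consistent L \<longleftrightarrow> (\<nexists>x. Pos x \<in> L \<and> Neg x \<in> L)"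

text \<open>An assignment to a set of variables is the set of literals it makes true.\<close>

definition assignment_to :: "'x set \<Rightarrow> 'x lit set \<Rightarrow> bool" where
  "assignment_to V S \<longleftrightarrow> lit_var ` S = V \<and> consistent S"

definition satisfying_assignments :: "('v, 'e, 'x) branching_program \<Rightarrow> 'x lit set set" where
  "satisfying_assignments Z = {S. assignment_to (vars Z) S \<and>
     (\<exists>p. source_sink_path Z p \<and> consistent (path_labels Z p) \<and> path_labels Z p \<subseteq> S)}"

definition monotone_nbp :: "('v, 'e, 'x) branching_program \<Rightarrow> bool" where
  "monotone_nbp Z \<longleftrightarrow> nbp Z \<and> (\<forall>e \<in> arcs (graph Z). \<forall>x. label Z e \<noteq> Some (Neg x))"

definition read_once :: "('v, 'e, 'x) branching_program \<Rightarrow> 'e list \<Rightarrow> bool" where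
  "read_once Z p \<longleftrightarrow> (\<forall>e \<in> set p. \<forall>f \<in> set p. \<forall>x.
     edge_var Z e = Some x \<longrightarrow> edge_var Z f = Some x \<longrightarrow> e = f)"

definition smnbp :: "nat \<Rightarrow> ('v, 'e, 'x) branching_program \<Rightarrow> bool" where
  "smnbp d Z \<longleftrightarrow> monotone_nbp Z \<and>
     (\<forall>u p v x. path Z u p v \<longrightarrow> card {e \<in> set p. edge_var Z e = Some x} \<le> d) \<and>
     (\<forall>p. source_sink_path Z p \<longrightarrow>
        (\<exists>ps. concat ps = p \<and> length ps \<le> d \<and> (\<forall>q \<in> set ps. read_once Z q)))"

text \<open>The list \<open>us\<close> is $u_1, \dots, u_{a+1}$. A path does not repeat vertices, so \<open>subseq\<close> says
  that the entries of \<open>us\<close> are distinct vertices of \<open>p\<close> listed in the order of \<open>p\<close>. The case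
  $a = 0$ arises only if the source is the sink.\<close>

definition has_yardsticks :: "nat \<Rightarrow> ('v, 'e, 'x) branching_program \<Rightarrow> bool" where
  "has_yardsticks d Z \<longleftrightarrow> (\<forall>p. source_sink_path Z p \<longrightarrow>
     (\<exists>us a. length us = a + 1 \<and> a \<le> d \<and>
        subseq us (pre_digraph.awalk_verts (graph Z) (source Z) p) \<and>
        us ! 0 = source Z \<and> us ! a = sink Z \<and>
        (\<forall>i < a. \<forall>q. path Z (us ! i) q (us ! (i + 1)) \<longrightarrow> read_once Z q)))"

definition same_function ::
  "('v, 'e, 'x) branching_program \<Rightarrow> ('w, 'f, 'x) branching_program \<Rightarrow> bool" where
  "same_function Z Z' \<longleftrightarrow> vars Z = vars Z' \<and> satisfying_assignments Z = satisfying_assignments Z'"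

end

theory Submission
  imports Defs
begin

text \<open>Call the level of a vertex \<open>v\<close> the largest number of read-once pieces that a walk from the
  source to \<open>v\<close> needs, minus one; define the level of an arc in the same way by the walks that end
  with this arc. Levels do not decrease along a path, they are less than \<open>d\<close> at the sink, and a
  path on which the level stays constant is read-once: a repeated variable would force the worst
  walk to its start to need one more piece.

  Replace every arc \<open>e\<close> by three consecutive arcs, the middle one carrying the label of \<open>e\<close>, and give
  both new vertices the level of \<open>e\<close>. Then the level rises only along unlabelled arcs that are the
  only arc into, or the only arc out of, the new vertex on them. Taking this new vertex as a
  yardstick at every rise, all paths between consecutive yardsticks are read-once, because
  their labelled arcs lie in a single level.\<close>

section \<open>Cutting arc lists into read-once pieces\<close>

definition splits :: "('v, 'e, 'x) branching_program \<Rightarrow> nat \<Rightarrow> 'e list \<Rightarrow> bool" where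
  "splits Z k p \<longleftrightarrow> (\<exists>ps. concat ps = p \<and> length ps \<le> k \<and> (\<forall>q \<in> set ps. read_once Z q))"

lemma read_once_subset: "read_once Z q \<Longrightarrow> set p \<subseteq> set q \<Longrightarrow> read_once Z p"
  unfolding read_once_def by blast

lemma read_once_Nil [simp]: "read_once Z []"
  and read_once_singleton: "read_once Z [e]"
  by (auto simp: read_once_def)

lemma splits_length: "splits Z (length p) p"
  unfolding splits_def
  by (rule exI[of _ "map (\<lambda>e. [e]) p"]) (auto simp: read_once_singleton)

lemma splits_mono: "splits Z k p \<Longrightarrow> k \<le> l \<Longrightarrow> splits Z l p"
  unfolding splits_def using le_trans by blast

lemma splits_1_iff [simp]: "splits Z (Suc 0) p \<longleftrightarrow> read_once Z p"
proof
  assume "splits Z (Suc 0) p"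
  then obtain ps where ps: "concat ps = p" "length ps \<le> Suc 0" "\<forall>q \<in> set ps. read_once Z q"
    unfolding splits_def by blast
  then show "read_once Z p" by (cases ps) auto
qed (auto simp: splits_def intro!: exI[of _ "[p]"])

text \<open>Induction over the pieces: a first piece that lies inside \<open>p\<close> is kept; if
  \<open>p\<close> ends inside it, then \<open>p\<close> is itself read-once and forms a single
  piece.\<close>

lemma splits_prefix:
  assumes "splits Z k (p @ q)"
  shows "splits Z k p"
proof -
  have "\<exists>ps'. concat ps' = p \<and> length ps' \<le> length ps \<and> (\<forall>q \<in> set ps'. read_once Z q)"
    if "concat ps = p @ q" "\<forall>q \<in> set ps. read_once Z q" for ps
    using that
  proof (induction ps arbitrary: p)
    case (Cons x xs)
    then obtain us where
      "p = x @ us \<and> concat xs = us @ q \<or> x = p @ us"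
      by (auto simp: append_eq_append_conv2)
    then show ?case
    proof
      assume *: "p = x @ us \<and> concat xs = us @ q"
      with Cons obtain ps' where
        "concat ps' = us" "length ps' \<le> length xs" "\<forall>q \<in> set ps'. read_once Z q"
        by fastforce
      with * Cons.prems show ?thesis
        by (intro exI[of _ "x # ps'"]) auto
    next
      assume "x = p @ us"
      with Cons.prems have "read_once Z p" by (auto elim: read_once_subset)
      then show ?thesis by (intro exI[of _ "[p]"]) auto
    qed
  qed auto
  with assms show ?thesis unfolding splits_def by (meson le_trans)
qed

text \<open>The last piece of a splitting of \<open>p @ q\<close> does not contain all of \<open>q\<close>, so the other pieces
  cover \<open>p @ [hd q]\<close>.\<close>

lemma splits_Suc_append:
  assumes "splits Z (Suc k) (p @ q)" and "\<not> read_once Z q"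
  shows "splits Z k (p @ [hd q])"
proof -
  obtain ps where ps: "concat ps = p @ q" "length ps \<le> Suc k" "\<forall>q \<in> set ps. read_once Z q"
    using assms(1) unfolding splits_def by blast
  have "q \<noteq> []" using assms(2) by auto
  with ps(1) have "ps \<noteq> []" by auto
  then obtain ps' s where s: "ps = ps' @ [s]" by (metis append_butlast_last_id)
  with ps(1) obtain t where
    "concat ps' = p @ t \<and> q = t @ s \<or> p = concat ps' @ t \<and> s = t @ q"
    by (auto simp: append_eq_append_conv2)
  moreover have "\<not> set q \<subseteq> set s" using ps(3) s assms(2) read_once_subset by fastforce
  ultimately have t: "concat ps' = p @ t" "q = t @ s" by auto
  have "t \<noteq> []" using t(2) \<open>\<not> set q \<subseteq> set s\<close> by auto
  with t have "concat ps' = (p @ [hd q]) @ tl t" by (cases t) auto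
  with ps(2,3) s have "splits Z k ((p @ [hd q]) @ tl t)"
    unfolding splits_def by (intro exI[of _ ps']) auto
  then show ?thesis by (rule splits_prefix)
qed

section \<open>Levels of vertices and arcs in an acyclic program\<close>

locale acyclic_program = fin_digraph "graph Z" for Z :: "('v, 'e, 'x) branching_program" +
  assumes acyclic: "\<nexists>p. cycle p"
begin

lemma awalk_closed_Nil: "awalk u p u \<Longrightarrow> p = []"
  using acyclic closed_w_imp_cycle unfolding closed_w_def by blast

text \<open>A walk that repeats a vertex contains a nonempty closed walk, which acyclicity forbids.
  So walks, which concatenate freely, can replace paths everywhere.\<close>

lemma apath_iff_awalk: "apath u p v \<longleftrightarrow> awalk u p v"
proof
  assume p: "awalk u p v"
  have "distinct (awalk_verts u p)"
  proof (rule ccontr)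
    assume "\<not> ?thesis"
    with p obtain q r s w where "awalk w r w" "r \<noteq> []"
      using awalk_not_distinct_decomp by blast
    then show False using awalk_closed_Nil by blast
  qed
  with p show "apath u p v" unfolding apath_def by simp
qed (simp add: apath_def)

text \<open>The least common bound is the maximum over all walks. Counting from \<open>Suc k\<close>
  gives the source level 0, its only walk being empty; a vertex that no walk from the source reaches
  gets level 0 as well.\<close>

definition vert_level :: "'v \<Rightarrow> nat" where
  "vert_level v = (LEAST k. \<forall>p. awalk (source Z) p v \<longrightarrow> splits Z (Suc k) p)"

definition arc_level :: "'e \<Rightarrow> nat" where
  "arc_level e = (LEAST k. \<forall>p. awalk (source Z) p (tail (graph Z) e) \<longrightarrow> splits Z (Suc k) (p @ [e]))"

lemma awalk_length: "awalk u p v \<Longrightarrow> length p \<le> card (verts (graph Z))"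
  using length_apath apath_iff_awalk by auto

lemma splits_vert_level:
  assumes "awalk (source Z) p v"
  shows "splits Z (Suc (vert_level v)) p"
proof -
  have "\<forall>p. awalk (source Z) p v \<longrightarrow> splits Z (Suc (vert_level v)) p"
    unfolding vert_level_def
    \<comment> \<open>Some bound exists: walks have at most as many arcs as there are vertices, and
      single arcs are read-once pieces.\<close>
    by (rule LeastI[of _ "card (verts (graph Z))"])
      (meson splits_length splits_mono awalk_length le_SucI)
  with assms show ?thesis by blast
qed

lemma splits_arc_level:
  assumes "awalk (source Z) p (tail (graph Z) e)"
  shows "splits Z (Suc (arc_level e)) (p @ [e])"
proof -
  have "\<forall>p. awalk (source Z) p (tail (graph Z) e) \<longrightarrow> splits Z (Suc (arc_level e)) (p @ [e])"
    unfolding arc_level_def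
  proof (rule LeastI[of _ "card (verts (graph Z))"], intro allI impI)
    fix p assume "awalk (source Z) p (tail (graph Z) e)"
    then have "length (p @ [e]) \<le> Suc (card (verts (graph Z)))"
      using awalk_length by simp
    then show "splits Z (Suc (card (verts (graph Z)))) (p @ [e])"
      using splits_length splits_mono by blast
  qed
  with assms show ?thesis by blast
qed

lemma vert_level_le:
  "(\<And>p. awalk (source Z) p v \<Longrightarrow> splits Z (Suc k) p) \<Longrightarrow> vert_level v \<le> k"
  unfolding vert_level_def by (rule Least_le) blast

lemma arc_level_le:
  "(\<And>p. awalk (source Z) p (tail (graph Z) e) \<Longrightarrow> splits Z (Suc k) (p @ [e])) \<Longrightarrow> arc_level e \<le> k"
  unfolding arc_level_def by (rule Least_le) blast

lemma vert_level_tail_le: "vert_level (tail (graph Z) e) \<le> arc_level e"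
  using splits_arc_level splits_prefix by (intro vert_level_le) blast

text \<open>The walks that end with \<open>e\<close> are among the walks to the head of
  \<open>e\<close>.\<close>

lemma arc_level_le_head:
  assumes "e \<in> arcs (graph Z)"
  shows "arc_level e \<le> vert_level (head (graph Z) e)"
proof (rule arc_level_le)
  fix p assume "awalk (source Z) p (tail (graph Z) e)"
  with assms have "awalk (source Z) (p @ [e]) (head (graph Z) e)"
    by (auto intro!: awalk_appendI arc_implies_awalk)
  then show "splits Z (Suc (vert_level (head (graph Z) e))) (p @ [e])"
    by (rule splits_vert_level)
qed

end

section \<open>The subdivided program, coded in natural numbers\<close>

locale subdivision = acyclic_program Z for Z :: "('v, 'e, 'x) branching_program" +
  fixes \<phi> :: "'v \<Rightarrow> nat" and \<psi> :: "'e \<Rightarrow> nat"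
  assumes inj_\<phi>: "inj_on \<phi> (verts (graph Z))" and inj_\<psi>: "inj_on \<psi> (arcs (graph Z))"
begin

abbreviation "G \<equiv> graph Z"

text \<open>The residue modulo 3 tells the three kinds of vertices apart, and likewise the three
  kinds of arcs; the quotient recovers the original vertex or arc. A vertex and an arc may share a
  code.\<close>

definition V :: "'v \<Rightarrow> nat" where "V v = 3 * \<phi> v"
definition A :: "'e \<Rightarrow> nat" where "A e = 3 * \<psi> e + 1"
definition B :: "'e \<Rightarrow> nat" where "B e = 3 * \<psi> e + 2"
definition E0 :: "'e \<Rightarrow> nat" where "E0 e = 3 * \<psi> e"
definition E1 :: "'e \<Rightarrow> nat" where "E1 e = 3 * \<psi> e + 1"
definition E2 :: "'e \<Rightarrow> nat" where "E2 e = 3 * \<psi> e + 2"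

definition orig_vert :: "nat \<Rightarrow> 'v" where "orig_vert n = inv_into (verts G) \<phi> (n div 3)"
definition orig_arc :: "nat \<Rightarrow> 'e" where "orig_arc n = inv_into (arcs G) \<psi> (n div 3)"

text \<open>Every arc \<open>e\<close> from \<open>u\<close> to \<open>v\<close> becomes
  \<open>V u \<midarrow>E0 e\<rightarrow> A e \<midarrow>E1 e\<rightarrow> B e \<midarrow>E2 e\<rightarrow> V v\<close>, with the label of \<open>e\<close> on \<open>E1 e\<close>.\<close>

definition subdiv :: "(nat, nat, 'x) branching_program" where
  "subdiv = \<lparr>graph = \<lparr>
      verts = V ` verts G \<union> A ` arcs G \<union> B ` arcs G,
      arcs = E0 ` arcs G \<union> E1 ` arcs G \<union> E2 ` arcs G,
      tail = (\<lambda>n. let e = orig_arc n in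
        if n mod 3 = 0 then V (tail G e) else if n mod 3 = 1 then A e else B e),
      head = (\<lambda>n. let e = orig_arc n in
        if n mod 3 = 0 then A e else if n mod 3 = 1 then B e else V (head G e))\<rparr>,
    label = (\<lambda>n. if n mod 3 = 1 then label Z (orig_arc n) else None)\<rparr>"

definition proj :: "nat list \<Rightarrow> 'e list" where
  "proj P = map orig_arc (filter (\<lambda>n. n mod 3 = 1) P)"

text \<open>The effect of contracting all unlabelled outer arcs \<open>E0 e\<close> and
  \<open>E2 e\<close>: \<open>A e\<close> merges with the tail of \<open>e\<close> and
  \<open>B e\<close> with its head.\<close>

definition base :: "nat \<Rightarrow> 'v" where
  "base n = (if n mod 3 = 0 then orig_vert n
    else if n mod 3 = 1 then tail G (orig_arc n) else head G (orig_arc n))"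

definition level :: "nat \<Rightarrow> nat" where
  "level n = (if n mod 3 = 0 then vert_level (orig_vert n) else arc_level (orig_arc n))"

definition lift :: "'e list \<Rightarrow> nat list" where
  "lift p = concat (map (\<lambda>e. [E0 e, E1 e, E2 e]) p)"

lemma mod3 [simp]:
  "V v mod 3 = 0" "A e mod 3 = 1" "B e mod 3 = 2" "E0 e mod 3 = 0" "E1 e mod 3 = 1" "E2 e mod 3 = 2"
  unfolding V_def A_def B_def E0_def E1_def E2_def by presburger+

lemma orig_vert_V [simp]: "v \<in> verts G \<Longrightarrow> orig_vert (V v) = v"
  by (simp add: orig_vert_def V_def inj_\<phi>)

lemma orig_arc_simps [simp]:
  assumes "e \<in> arcs G"
  shows "orig_arc (A e) = e" "orig_arc (B e) = e"
    "orig_arc (E0 e) = e" "orig_arc (E1 e) = e" "orig_arc (E2 e) = e"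
proof -
  have "(3 * n + 1) div 3 = n" "(3 * n + 2) div 3 = n" for n :: nat by presburger+
  with assms show "orig_arc (A e) = e" "orig_arc (B e) = e"
    "orig_arc (E0 e) = e" "orig_arc (E1 e) = e" "orig_arc (E2 e) = e"
    by (simp_all only: orig_arc_def A_def B_def E0_def E1_def E2_def) (simp_all add: inj_\<psi>)
qed

lemma distinct_codes [simp]:
  "V v \<noteq> A e" "V v \<noteq> B e" "A e \<noteq> V v" "B e \<noteq> V v" "A e \<noteq> B f" "B f \<noteq> A e"
  "E0 e \<noteq> E1 f" "E1 f \<noteq> E0 e" "E0 e \<noteq> E2 f" "E2 f \<noteq> E0 e" "E1 e \<noteq> E2 f" "E2 f \<noteq> E1 e"
  unfolding V_def A_def B_def E0_def E1_def E2_def by presburger+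

lemma inj_codes [simp]:
  "u \<in> verts G \<Longrightarrow> v \<in> verts G \<Longrightarrow> V u = V v \<longleftrightarrow> u = v"
  "e \<in> arcs G \<Longrightarrow> f \<in> arcs G \<Longrightarrow> A e = A f \<longleftrightarrow> e = f"
  "e \<in> arcs G \<Longrightarrow> f \<in> arcs G \<Longrightarrow> B e = B f \<longleftrightarrow> e = f"
  "e \<in> arcs G \<Longrightarrow> f \<in> arcs G \<Longrightarrow> E0 e = E0 f \<longleftrightarrow> e = f"
  "e \<in> arcs G \<Longrightarrow> f \<in> arcs G \<Longrightarrow> E1 e = E1 f \<longleftrightarrow> e = f"
  "e \<in> arcs G \<Longrightarrow> f \<in> arcs G \<Longrightarrow> E2 e = E2 f \<longleftrightarrow> e = f"
  by (metis orig_vert_V orig_arc_simps)+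

lemma verts_subdiv: "verts (graph subdiv) = V ` verts G \<union> A ` arcs G \<union> B ` arcs G"
  and arcs_subdiv: "arcs (graph subdiv) = E0 ` arcs G \<union> E1 ` arcs G \<union> E2 ` arcs G"
  by (simp_all add: subdiv_def)

lemma ends_subdiv [simp]:
  assumes "e \<in> arcs G"
  shows "tail (graph subdiv) (E0 e) = V (tail G e)" "head (graph subdiv) (E0 e) = A e"
    "tail (graph subdiv) (E1 e) = A e" "head (graph subdiv) (E1 e) = B e"
    "tail (graph subdiv) (E2 e) = B e" "head (graph subdiv) (E2 e) = V (head G e)"
  using assms by (simp_all add: subdiv_def)

lemma label_subdiv [simp]:
  "label subdiv (E0 e) = None" "label subdiv (E2 e) = None"
  "e \<in> arcs G \<Longrightarrow> label subdiv (E1 e) = label Z e"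
  by (simp_all add: subdiv_def)

lemma proj_simps [simp]:
  "proj [] = []" "proj (P @ Q) = proj P @ proj Q"
  "proj (E0 e # P) = proj P" "proj (E2 e # P) = proj P"
  "e \<in> arcs G \<Longrightarrow> proj (E1 e # P) = e # proj P"
  by (simp_all add: proj_def)

lemma base_simps [simp]:
  "v \<in> verts G \<Longrightarrow> base (V v) = v"
  "e \<in> arcs G \<Longrightarrow> base (A e) = tail G e" "e \<in> arcs G \<Longrightarrow> base (B e) = head G e"
  by (simp_all add: base_def)

lemma level_simps [simp]:
  "v \<in> verts G \<Longrightarrow> level (V v) = vert_level v"
  "e \<in> arcs G \<Longrightarrow> level (A e) = arc_level e" "e \<in> arcs G \<Longrightarrow> level (B e) = arc_level e"
  by (simp_all add: level_def)

lemma lift_simps [simp]: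
  "lift [] = []" "lift (e # p) = E0 e # E1 e # E2 e # lift p" "lift (p @ q) = lift p @ lift q"
  by (simp_all add: lift_def)

lemma concat_map_lift: "concat (map lift ps) = lift (concat ps)"
  by (induction ps) auto

lemma proj_lift: "set p \<subseteq> arcs G \<Longrightarrow> proj (lift p) = p"
  by (induction p) auto

section \<open>Walks of the subdivision and its acyclicity\<close>

sublocale sub: fin_digraph "graph subdiv"
  by unfold_locales (auto simp: verts_subdiv arcs_subdiv)

lemma verts_subdiv_cases [consumes 1, case_names V A B]:
  assumes "x \<in> verts (graph subdiv)"
  obtains v where "v \<in> verts G" "x = V v" | e where "e \<in> arcs G" "x = A e"
    | e where "e \<in> arcs G" "x = B e"
  using assms by (auto simp: verts_subdiv)

text \<open>The arcs \<open>E0 e\<close> and \<open>E2 e\<close> join vertices with the same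
  \<open>base\<close>, and \<open>E1 e\<close> becomes \<open>e\<close>.\<close>

lemma awalk_proj: "sub.awalk x P y \<Longrightarrow> awalk (base x) (proj P) (base y)"
proof (induction P arbitrary: x)
  case Nil
  then show ?case by (auto simp: sub.awalk_Nil_iff awalk_Nil_iff verts_subdiv)
next
  case (Cons a P)
  then show ?case by (auto simp: sub.awalk_Cons_iff arcs_subdiv awalk_Cons_iff dest!: Cons.IH)
qed

lemma awalk_lift: "awalk u p v \<Longrightarrow> sub.awalk (V u) (lift p) (V v)"
  by (induction p arbitrary: u)
    (auto simp: sub.awalk_simps arcs_subdiv awalk_simps verts_subdiv)

lemma awalk_from_V:
  assumes "u \<in> verts G" "sub.awalk (V u) P y"
  obtains "P = []" "y = V u" | e Q where "e \<in> arcs G" "tail G e = u" "P = E0 e # Q" "sub.awalk (A e) Q y"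
  using assms by (cases P) (auto simp: sub.awalk_simps arcs_subdiv)

lemma awalk_from_A:
  assumes "e \<in> arcs G" "sub.awalk (A e) P y"
  obtains "P = []" "y = A e" | Q where "P = E1 e # Q" "sub.awalk (B e) Q y"
  using assms by (cases P) (auto simp: sub.awalk_simps arcs_subdiv)

lemma awalk_from_B:
  assumes "e \<in> arcs G" "sub.awalk (B e) P y"
  obtains "P = []" "y = B e" | Q where "P = E2 e # Q" "sub.awalk (V (head G e)) Q y"
  using assms by (cases P) (auto simp: sub.awalk_simps arcs_subdiv)

text \<open>A new vertex has just one outgoing arc, so a walk that leaves \<open>V u\<close> by
  \<open>E0 e\<close> and ends at an original vertex must complete the triple of \<open>e\<close>.
  The induction is on length because three arcs are removed at a time.\<close>

lemma awalk_VE: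
  assumes "sub.awalk (V u) P (V v)" "u \<in> verts G" "v \<in> verts G"
  obtains p where "awalk u p v" "P = lift p"
proof -
  have "\<exists>p. P = lift p \<and> set p \<subseteq> arcs G"
    using assms(1,2)
  proof (induction P arbitrary: u rule: length_induct)
    case (1 P)
    show ?case
    proof (cases rule: awalk_from_V[OF 1(3) 1(2)])
      case 1
      then show ?thesis by (intro exI[of _ "[]"]) auto
    next
      case (2 e Q)
      obtain Q' where Q': "Q = E1 e # Q'" "sub.awalk (B e) Q' (V v)"
        by (rule awalk_from_A[OF 2(1) 2(4)]) auto
      obtain Q'' where Q'': "Q' = E2 e # Q''" "sub.awalk (V (head G e)) Q'' (V v)"
        by (rule awalk_from_B[OF 2(1) Q'(2)]) auto
      have "length Q'' < length P" "head G e \<in> verts G" using 2 Q' Q'' by auto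
      with 1(1) Q''(2) obtain p where "Q'' = lift p" "set p \<subseteq> arcs G" by blast
      with 2 Q' Q'' show ?thesis by (intro exI[of _ "e # p"]) auto
    qed
  qed
  then obtain p where p: "P = lift p" "set p \<subseteq> arcs G" by blast
  with awalk_proj[OF assms(1)] assms(2,3) have "awalk u p v" by (simp add: proj_lift)
  with p that show ?thesis by blast
qed

text \<open>A closed walk projects to a closed walk of \<open>Z\<close>, which is empty, so it
  contains no middle arc \<open>E1 e\<close>. The outer arcs alone lead at most from some
  \<open>B e\<close> through an original vertex to some \<open>A f\<close> and never close
  up.\<close>

lemma sub_acyclic: "\<nexists>P. sub.cycle P"
proof
  assume "\<exists>P. sub.cycle P"
  then obtain x P where P: "sub.awalk x P x" "P \<noteq> []" unfolding sub.cycle_def by blast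
  from P(1) have nil: "proj P = []" using awalk_proj awalk_closed_Nil by blast
  have fromV: "P' = [] \<and> y = V u \<or> (\<exists>e \<in> arcs G. y = A e)"
    if "u \<in> verts G" "sub.awalk (V u) P' y" "proj P' = []" for u P' y
    using that(1,2)
  proof (cases rule: awalk_from_V)
    case (2 e Q)
    from 2(1,4) show ?thesis by (rule awalk_from_A) (use 2 that(3) in auto)
  qed auto
  have "x \<in> verts (graph subdiv)" using P(1) by auto
  then show False
  proof (cases rule: verts_subdiv_cases)
    case (V v)
    with fromV[of v P x] P nil show ?thesis by auto
  next
    case (A e)
    from A(1) P(1)[unfolded A(2)] show ?thesis
      by (rule awalk_from_A) (use P(2) nil A in auto)
  next
    case (B e)
    from B(1) P(1)[unfolded B(2)] show ?thesis
    proof (cases rule: awalk_from_B)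
      case (2 Q)
      with fromV[of "head G e" Q x] B nil show ?thesis by auto
    qed (use P(2) in simp)
  qed
qed

sublocale sub: acyclic_program subdiv
  by unfold_locales (rule sub_acyclic)

section \<open>Source, sink, size and labels of the subdivision\<close>

lemma is_source_V: "v \<in> verts G \<Longrightarrow> is_source subdiv (V v) \<longleftrightarrow> is_source Z v"
  unfolding is_source_def in_arcs_def by (auto simp: verts_subdiv arcs_subdiv)

lemma is_sink_V: "v \<in> verts G \<Longrightarrow> is_sink subdiv (V v) \<longleftrightarrow> is_sink Z v"
  unfolding is_sink_def out_arcs_def by (auto simp: verts_subdiv arcs_subdiv)

lemma is_source_subdiv: "is_source subdiv x \<longleftrightarrow> (\<exists>v. x = V v \<and> is_source Z v)"
proof
  assume x: "is_source subdiv x"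
  then have "x \<in> verts (graph subdiv)" by (simp add: is_source_def)
  then show "\<exists>v. x = V v \<and> is_source Z v"
  proof (cases rule: verts_subdiv_cases)
    case (V v)
    with x is_source_V show ?thesis by auto
  next
    case (A e)
    then have "E0 e \<in> in_arcs (graph subdiv) x" by (auto simp: in_arcs_def arcs_subdiv)
    with x show ?thesis by (auto simp: is_source_def)
  next
    case (B e)
    then have "E1 e \<in> in_arcs (graph subdiv) x" by (auto simp: in_arcs_def arcs_subdiv)
    with x show ?thesis by (auto simp: is_source_def)
  qed
next
  assume "\<exists>v. x = V v \<and> is_source Z v"
  then show "is_source subdiv x" using is_source_V is_source_def by metis
qed

lemma is_sink_subdiv: "is_sink subdiv x \<longleftrightarrow> (\<exists>v. x = V v \<and> is_sink Z v)"
proof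
  assume x: "is_sink subdiv x"
  then have "x \<in> verts (graph subdiv)" by (simp add: is_sink_def)
  then show "\<exists>v. x = V v \<and> is_sink Z v"
  proof (cases rule: verts_subdiv_cases)
    case (V v)
    with x is_sink_V show ?thesis by auto
  next
    case (A e)
    then have "E1 e \<in> out_arcs (graph subdiv) x" by (auto simp: out_arcs_def arcs_subdiv)
    with x show ?thesis by (auto simp: is_sink_def)
  next
    case (B e)
    then have "E2 e \<in> out_arcs (graph subdiv) x" by (auto simp: out_arcs_def arcs_subdiv)
    with x show ?thesis by (auto simp: is_sink_def)
  qed
next
  assume "\<exists>v. x = V v \<and> is_sink Z v"
  then show "is_sink subdiv x" using is_sink_V is_sink_def by metis
qed

lemma num_edges_subdiv: "num_edges subdiv \<le> 3 * num_edges Z"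
proof -
  have "card (arcs (graph subdiv)) \<le> card (E0 ` arcs G) + card (E1 ` arcs G) + card (E2 ` arcs G)"
    unfolding arcs_subdiv by (meson add_le_mono1 card_Un_le le_trans)
  also have "\<dots> \<le> card (arcs G) + card (arcs G) + card (arcs G)"
    by (intro add_mono card_image_le) auto
  finally show ?thesis by (simp add: num_edges_def)
qed

lemma edge_var_subdiv [simp]:
  "edge_var subdiv (E0 e) = None" "edge_var subdiv (E2 e) = None"
  "e \<in> arcs G \<Longrightarrow> edge_var subdiv (E1 e) = edge_var Z e"
  by (simp_all add: edge_var_def)

lemma vars_subdiv: "vars subdiv = vars Z"
  unfolding vars_def arcs_subdiv by (simp add: bex_Un)

lemma path_labels_lift: "set p \<subseteq> arcs G \<Longrightarrow> path_labels subdiv (lift p) = path_labels Z p"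
  by (auto simp: path_labels_def lift_def) force+

text \<open>Only middle arcs carry variables, so both the number of occurrences of a variable and
  read-onceness can be checked on the projection.\<close>

lemma arcs_with_var:
  assumes "set P \<subseteq> arcs (graph subdiv)"
  shows "{a \<in> set P. edge_var subdiv a = Some x} = E1 ` {e \<in> set (proj P). edge_var Z e = Some x}"
proof -
  have "set (proj P) = {e \<in> arcs G. E1 e \<in> set P}"
    using assms by (induction P) (auto simp: arcs_subdiv)
  with assms show ?thesis by (auto simp: arcs_subdiv)
qed

lemma read_once_subdiv:
  assumes "set P \<subseteq> arcs (graph subdiv)" "read_once Z (proj P)"
  shows "read_once subdiv P"
proof (unfold read_once_def, intro ballI allI impI)
  fix a b x
  assume "a \<in> set P" "b \<in> set P" "edge_var subdiv a = Some x" "edge_var subdiv b = Some x"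
  then have "a \<in> {a \<in> set P. edge_var subdiv a = Some x}" "b \<in> {a \<in> set P. edge_var subdiv a = Some x}"
    by auto
  then show "a = b"
    unfolding arcs_with_var[OF assms(1)] using assms(2) unfolding read_once_def by blast
qed

section \<open>Walks within one level are read-once\<close>

lemma splits_level:
  assumes "sub.awalk (V (source Z)) P x" and s: "source Z \<in> verts G"
  shows "splits Z (Suc (level x)) (proj P)"
proof -
  have p: "awalk (source Z) (proj P) (base x)" using awalk_proj[OF assms(1)] s by simp
  have "x \<in> verts (graph subdiv)" using assms(1) by auto
  then show ?thesis
  proof (cases rule: verts_subdiv_cases)
    case (V v)
    with p show ?thesis using splits_vert_level by auto
  next
    case (A e)
    \<comment> \<open>The projected walk ends at the tail of \<open>e\<close>, whose level is at
      most that of \<open>e\<close>.\<close>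
    with p show ?thesis using splits_vert_level vert_level_tail_le splits_mono Suc_le_mono
      by (metis base_simps(2) level_simps(2))
  next
    case (B e)
    \<comment> \<open>The only arc into \<open>B e\<close> is \<open>E1 e\<close>, so the projection
      ends with \<open>e\<close> and the level of \<open>e\<close> bounds its pieces.\<close>
    then have "P \<noteq> []" using assms(1) by (auto simp: sub.awalk_Nil_iff)
    then obtain Q a where Q: "P = Q @ [a]" by (metis append_butlast_last_id)
    with assms(1) B have "a = E1 e" "sub.awalk (V (source Z)) Q (A e)"
      by (auto simp: sub.awalk_simps arcs_subdiv)
    with awalk_proj[of "V (source Z)" Q "A e"] s B Q show ?thesis
      using splits_arc_level by auto
  qed
qed

text \<open>Minimality of the level provides a worst walk. The arc \<open>hd (proj Q)\<close> is
  appended because of \<open>A e\<close>: the witness for the level of \<open>e\<close> contains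
  \<open>e\<close>, which a walk to \<open>A e\<close> has not yet passed. At the other vertices the
  projection of \<open>P\<close> alone already exceeds the bound.\<close>

lemma exceeds_level:
  assumes "level x = Suc k" "sub.awalk x Q y" "proj Q \<noteq> []"
  obtains P where "sub.awalk (V (source Z)) P x" "\<not> splits Z (Suc k) (proj P @ [hd (proj Q)])"
proof -
  have "x \<in> verts (graph subdiv)" using assms(2) by auto
  then show thesis
  proof (cases rule: verts_subdiv_cases)
    case (V v)
    with assms(1) have "\<not> vert_level v \<le> k" by simp
    then obtain p where p: "awalk (source Z) p v" "\<not> splits Z (Suc k) p"
      using vert_level_le by blast
    then have "sub.awalk (V (source Z)) (lift p) x" "proj (lift p) = p"
      using awalk_lift V by (auto intro!: proj_lift)
    with p(2) that splits_prefix show thesis by metis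
  next
    case (A e)
    with assms(1) have "\<not> arc_level e \<le> k" by simp
    then obtain p where p: "awalk (source Z) p (tail G e)" "\<not> splits Z (Suc k) (p @ [e])"
      using arc_level_le by blast
    have "sub.awalk (V (source Z)) (lift p @ [E0 e]) x"
      using awalk_lift[OF p(1)] A by (auto simp: sub.awalk_simps arcs_subdiv verts_subdiv)
    moreover have "proj (lift p @ [E0 e]) = p" using p(1) by (auto intro!: proj_lift)
    \<comment> \<open>The only way out of \<open>A e\<close> is \<open>E1 e\<close>.\<close>
    moreover have "hd (proj Q) = e"
      using A(1) assms(2)[unfolded A(2)] by (rule awalk_from_A) (use assms(3) A(1) in auto)
    ultimately show thesis using p(2) that by metis
  next
    case (B e)
    with assms(1) have "\<not> arc_level e \<le> k" by simp
    then obtain p where p: "awalk (source Z) p (tail G e)" "\<not> splits Z (Suc k) (p @ [e])"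
      using arc_level_le by blast
    have "sub.awalk (V (source Z)) (lift p @ [E0 e, E1 e]) x"
      using awalk_lift[OF p(1)] B by (auto simp: sub.awalk_simps arcs_subdiv verts_subdiv)
    moreover have "proj (lift p @ [E0 e, E1 e]) = p @ [e]"
      using p(1) B by (auto intro!: proj_lift)
    ultimately show thesis using p(2) that splits_prefix by metis
  qed
qed

text \<open>Suppose \<open>proj Q\<close> is not read-once, and prolong a worst walk
  \<open>P\<close> to \<open>x\<close> by \<open>Q\<close>. The level of \<open>y\<close> allows
  \<open>Suc (Suc k)\<close> pieces, so by \<open>splits_Suc_append\<close> one piece fewer suffices
  for \<open>proj P @ [hd (proj Q)]\<close>, contrary to the choice of \<open>P\<close>. Level 0
  yields no worst walk; there \<open>Q\<close> starts at the source and splits into one piece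
  directly.\<close>

lemma read_once_same_level:
  assumes Q: "sub.awalk x Q y" and le: "level y \<le> level x"
    and s: "source Z \<in> verts G" and 0: "level x = 0 \<Longrightarrow> x = V (source Z)"
  shows "read_once Z (proj Q)"
proof (cases "level x")
  case 0
  with splits_level[OF _ s, of Q y] Q le assms(4) show ?thesis by auto
next
  case (Suc k)
  show ?thesis
  proof (rule ccontr)
    assume nro: "\<not> ?thesis"
    then have "proj Q \<noteq> []" by auto
    then obtain P where P: "sub.awalk (V (source Z)) P x"
      "\<not> splits Z (Suc k) (proj P @ [hd (proj Q)])"
      using exceeds_level Suc Q by blast
    have "sub.awalk (V (source Z)) (P @ Q) y" using P(1) Q by (rule sub.awalk_appendI)
    from splits_level[OF this s] have "splits Z (Suc (level y)) (proj P @ proj Q)" by simp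
    then have "splits Z (Suc (Suc k)) (proj P @ proj Q)"
      by (rule splits_mono) (use le Suc in simp)
    with nro P(2) show False using splits_Suc_append by blast
  qed
qed

text \<open>\<open>B e\<close> has out-degree 1 and \<open>A e\<close> has in-degree 1, both through unlabelled arcs. Hence \<open>B e\<close>
  may begin a stretch at the level of the head of \<open>e\<close>, and \<open>A e\<close> may end a stretch at the level of
  the tail of \<open>e\<close>.\<close>

definition begins_level :: "nat \<Rightarrow> nat \<Rightarrow> bool" where
  "begins_level x j \<longleftrightarrow> (level x = j \<or> (\<exists>e \<in> arcs G. x = B e \<and> vert_level (head G e) = j)) \<and>
     (j = 0 \<longrightarrow> x = V (source Z))"

definition ends_level :: "nat \<Rightarrow> nat \<Rightarrow> bool" where
  "ends_level y j \<longleftrightarrow> level y = j \<or> (\<exists>e \<in> arcs G. y = A e \<and> vert_level (tail G e) = j)"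

definition read_once_between :: "nat \<Rightarrow> nat \<Rightarrow> bool" where
  "read_once_between x y \<longleftrightarrow> (\<forall>Q. sub.awalk x Q y \<longrightarrow> read_once subdiv Q)"

text \<open>Removing an unlabelled first arc \<open>E2 e\<close> or last arc \<open>E0 e\<close>
  where needed leaves a walk between two vertices of level \<open>j\<close> with the same
  projection.\<close>

lemma read_once_between_levels:
  assumes s: "source Z \<in> verts G" and x: "begins_level x j" and y: "ends_level y j"
  shows "read_once_between x y"
proof -
  have *: "read_once Z (proj Q)"
    if Q: "sub.awalk x Q y" and x: "level x = j" "j = 0 \<longrightarrow> x = V (source Z)" for x Q
  proof (cases "level y = j")
    case True
    with Q x s show ?thesis by (intro read_once_same_level[of x Q y]) auto
  next
    case False
    with y obtain e where e: "e \<in> arcs G" "y = A e" "vert_level (tail G e) = j"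
      unfolding ends_level_def by blast
    show ?thesis
    proof (cases Q rule: rev_cases)
      case (snoc Q' a)
      with Q e have "a = E0 e" "sub.awalk x Q' (V (tail G e))"
        by (auto simp: sub.awalk_simps arcs_subdiv)
      moreover from this(2) have "read_once Z (proj Q')"
        by (rule read_once_same_level) (use e x s in auto)
      ultimately show ?thesis using snoc by simp
    qed simp
  qed
  have "read_once Z (proj Q)" if Q: "sub.awalk x Q y" for Q
  proof (cases "level x = j")
    case True
    with *[OF Q True] x show ?thesis unfolding begins_level_def by blast
  next
    case False
    \<comment> \<open>Here \<open>j = 0\<close> would make \<open>x\<close> the source vertex, which
      differs from every \<open>B e\<close>.\<close>
    with x obtain e where e: "e \<in> arcs G" "x = B e" "vert_level (head G e) = j" "j \<noteq> 0"
      unfolding begins_level_def by auto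
    from e(1) Q[unfolded e(2)] show ?thesis
      by (rule awalk_from_B) (use * e in auto)
  qed
  then show ?thesis
    unfolding read_once_between_def by (auto intro!: read_once_subdiv)
qed

section \<open>Yardsticks along a path\<close>

definition yardsticks :: "'e list \<Rightarrow> nat list" where
  "yardsticks p = concat (map (\<lambda>e.
     (if vert_level (tail G e) < arc_level e then [A e] else []) @
     (if arc_level e < vert_level (head G e) then [B e] else [])) p)"

text \<open>The vertex \<open>x\<close> is the latest yardstick so far, and it varies in the
  induction. A rise on \<open>E0 e\<close> lets \<open>A e\<close> end the level of the tail and
  begin that of \<open>e\<close>; a rise on \<open>E2 e\<close> lets \<open>B e\<close> end the
  level of \<open>e\<close> and begin that of the head. Each yardstick accounts for a rise of at
  least one, which bounds their number.\<close>

lemma yardsticks_chain: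
  assumes s: "source Z \<in> verts G"
  shows "awalk u p v \<Longrightarrow> begins_level x (vert_level u) \<Longrightarrow>
    successively read_once_between (x # yardsticks p @ [V v]) \<and>
    length (yardsticks p) + vert_level u \<le> vert_level v"
proof (induction p arbitrary: u x)
  case Nil
  then show ?case
    using read_once_between_levels[OF s]
    by (auto simp: yardsticks_def awalk_simps ends_level_def)
next
  case (Cons e p)
  then have e: "e \<in> arcs G" "tail G e = u" "awalk (head G e) p v" by (auto simp: awalk_simps)
  let ?l = "vert_level u" and ?m = "arc_level e" and ?h = "vert_level (head G e)"
  have le: "?l \<le> ?m" "?m \<le> ?h" using vert_level_tail_le arc_level_le_head e by auto
  \<comment> \<open>\<open>y\<close> and \<open>z\<close> are the latest yardsticks after
    \<open>A e\<close> and after \<open>B e\<close> have been passed. A level just reached by a rise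
    is positive, so the clause of \<open>begins_level\<close> for level 0 only concerns an unchanged
    yardstick.\<close>
  define y where "y = (if ?l < ?m then A e else x)"
  define z where "z = (if ?m < ?h then B e else y)"
  have y: "begins_level y ?m" using Cons.prems le e by (auto simp: y_def begins_level_def)
  have z: "begins_level z ?h" using y le e by (auto simp: z_def begins_level_def)
  have xA: "read_once_between x (A e)"
    by (rule read_once_between_levels[OF s Cons.prems(2)]) (use e in \<open>auto simp: ends_level_def\<close>)
  have yB: "read_once_between y (B e)"
    by (rule read_once_between_levels[OF s y]) (use e in \<open>auto simp: ends_level_def\<close>)
  have ys: "yardsticks (e # p) =
    (if ?l < ?m then [A e] else []) @ (if ?m < ?h then [B e] else []) @ yardsticks p"
    using e by (simp add: yardsticks_def)
  show ?case
    using Cons.IH[OF e(3) z] le xA yB unfolding ys y_def z_def by (auto split: if_splits)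
qed

text \<open>The lifted walk visits \<open>A e\<close> and \<open>B e\<close> in this order for each
  arc \<open>e\<close>, and \<open>e\<close> contributes a sublist of these two. An empty
  \<open>p\<close> is excluded since its walk visits one vertex, which the list would name
  twice.\<close>

lemma subseq_yardsticks:
  assumes "awalk u p v" "p \<noteq> []"
  shows "subseq (V u # yardsticks p @ [V v]) (sub.awalk_verts (V u) (lift p))"
proof -
  have step: "subseq (yardsticks (e # p) @ [V v]) (A e # B e # vs)"
    if "subseq (yardsticks p @ [V v]) vs" for e p vs
    using that by (auto simp: yardsticks_def)
  have "subseq (yardsticks p @ [V v]) (sub.awalk_verts (V u) (lift p))"
    if "awalk u p v" for u p
    using that
  proof (induction p arbitrary: u)
    case (Cons e p)
    then have "subseq (yardsticks (e # p) @ [V v]) (A e # B e # sub.awalk_verts (V (head G e)) (lift p))"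
      by (intro step) (auto simp: awalk_simps)
    with Cons.prems show ?case by (auto simp: awalk_simps intro: list_emb_Cons)
  qed (auto simp: yardsticks_def awalk_simps)
  with step assms show ?thesis by (cases p) (auto simp: awalk_simps)
qed

section \<open>Transfer of the program properties to the subdivision\<close>

lemma
  assumes "nbp Z"
  shows is_source_source: "is_source Z (source Z)" and is_sink_sink: "is_sink Z (sink Z)"
  using assms unfolding nbp_def source_def sink_def by (auto intro: theI')

lemma
  assumes "nbp Z"
  shows source_in_verts: "source Z \<in> verts G" and sink_in_verts: "sink Z \<in> verts G"
  using is_source_source is_sink_sink assms by (auto simp: is_source_def is_sink_def)

lemma
  assumes "nbp Z"
  shows ex1_source_subdiv: "\<exists>!x. is_source subdiv x"
    and ex1_sink_subdiv: "\<exists>!x. is_sink subdiv x"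
  using assms unfolding nbp_def is_source_subdiv is_sink_subdiv by metis+

lemma nbp_subdiv: "nbp Z \<Longrightarrow> nbp subdiv"
  using sub.fin_digraph sub_acyclic ex1_source_subdiv ex1_sink_subdiv unfolding nbp_def by blast

lemma
  assumes "nbp Z"
  shows source_subdiv: "source subdiv = V (source Z)" and sink_subdiv: "sink subdiv = V (sink Z)"
proof -
  show "source subdiv = V (source Z)"
    unfolding source_def[of subdiv] using ex1_source_subdiv[OF assms]
    by (rule the1_equality) (use is_source_subdiv is_source_source[OF assms] in blast)
  show "sink subdiv = V (sink Z)"
    unfolding sink_def[of subdiv] using ex1_sink_subdiv[OF assms]
    by (rule the1_equality) (use is_sink_subdiv is_sink_sink[OF assms] in blast)
qed

lemma source_sink_path_subdiv:
  assumes "nbp Z"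
  shows "source_sink_path subdiv P \<longleftrightarrow> (\<exists>p. source_sink_path Z p \<and> P = lift p)"
  unfolding sub.apath_iff_awalk apath_iff_awalk source_subdiv[OF assms] sink_subdiv[OF assms]
  using awalk_VE source_in_verts sink_in_verts assms awalk_lift by metis

lemma same_function_subdiv:
  assumes "nbp Z"
  shows "same_function Z subdiv"
proof -
  have "path_labels subdiv (lift p) = path_labels Z p" if "source_sink_path Z p" for p
    using that apath_iff_awalk by (intro path_labels_lift) auto
  then have "(\<exists>P. source_sink_path subdiv P \<and> consistent (path_labels subdiv P) \<and> path_labels subdiv P \<subseteq> S)
    \<longleftrightarrow> (\<exists>p. source_sink_path Z p \<and> consistent (path_labels Z p) \<and> path_labels Z p \<subseteq> S)" for S
    unfolding source_sink_path_subdiv[OF assms] by metis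
  then show ?thesis
    unfolding same_function_def satisfying_assignments_def vars_subdiv by simp
qed

text \<open>Occurrences of a variable are bounded on paths between arbitrary vertices, so these
  paths are projected to \<open>Z\<close>. Source-sink paths are lifts, and their partitions are
  obtained by lifting the pieces.\<close>

lemma smnbp_subdiv:
  assumes Z: "smnbp d Z"
  shows "smnbp d subdiv"
proof -
  have nbp: "nbp Z" using Z unfolding smnbp_def monotone_nbp_def by blast
  have "label subdiv a \<noteq> Some (Neg x)" if "a \<in> arcs (graph subdiv)" for a x
    using that Z unfolding smnbp_def monotone_nbp_def by (auto simp: arcs_subdiv)
  with nbp_subdiv[OF nbp] have "monotone_nbp subdiv" unfolding monotone_nbp_def by blast
  moreover have "card {a \<in> set P. edge_var subdiv a = Some x} \<le> d" if "path subdiv y P z" for y P z x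
  proof -
    have P: "sub.awalk y P z" using that sub.apath_iff_awalk by blast
    then have "card {a \<in> set P. edge_var subdiv a = Some x}
        \<le> card {e \<in> set (proj P). edge_var Z e = Some x}"
      by (subst arcs_with_var) (auto intro!: card_image_le)
    also have "\<dots> \<le> d"
    proof -
      have "path Z (base y) (proj P) (base z)" using awalk_proj[OF P] apath_iff_awalk by blast
      then show ?thesis using Z unfolding smnbp_def by blast
    qed
    finally show ?thesis .
  qed
  moreover have "\<exists>ps. concat ps = P \<and> length ps \<le> d \<and> (\<forall>q \<in> set ps. read_once subdiv q)"
    if P: "source_sink_path subdiv P" for P
  proof -
    obtain p where p: "source_sink_path Z p" "P = lift p"
      using P source_sink_path_subdiv[OF nbp] by blast
    then obtain ps where ps: "concat ps = p" "length ps \<le> d" "\<forall>q \<in> set ps. read_once Z q"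
      using Z unfolding smnbp_def by blast
    have "read_once subdiv (lift q)" if "q \<in> set ps" for q
    proof -
      have "set q \<subseteq> set p" using that ps(1) by auto
      also have "set p \<subseteq> arcs G" using p(1) by (simp add: apath_iff_awalk awalk_def)
      finally have "set q \<subseteq> arcs G" .
      then have "set (lift q) \<subseteq> arcs (graph subdiv)" "proj (lift q) = q"
        by (auto simp: lift_def arcs_subdiv) (simp add: proj_lift flip: lift_def)
      then show ?thesis using ps(3) that by (intro read_once_subdiv) auto
    qed
    with ps p(2) show ?thesis
      by (intro exI[of _ "map lift ps"]) (auto simp: concat_map_lift)
  qed
  ultimately show ?thesis unfolding smnbp_def by blast
qed

lemma has_yardsticks_subdiv:
  assumes Z: "smnbp d Z" and d: "d \<ge> 1"
  shows "has_yardsticks d subdiv"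
proof (unfold has_yardsticks_def, intro allI impI)
  fix P assume "source_sink_path subdiv P"
  have nbp: "nbp Z" using Z unfolding smnbp_def monotone_nbp_def by blast
  note s = source_in_verts[OF nbp] and ends = source_subdiv[OF nbp] sink_subdiv[OF nbp]
  obtain p where p: "awalk (source Z) p (sink Z)" "P = lift p"
    using \<open>source_sink_path subdiv P\<close> source_sink_path_subdiv[OF nbp] apath_iff_awalk by blast
  show "\<exists>us a. length us = a + 1 \<and> a \<le> d \<and> subseq us (sub.awalk_verts (source subdiv) P) \<and>
    us ! 0 = source subdiv \<and> us ! a = sink subdiv \<and>
    (\<forall>i < a. \<forall>Q. path subdiv (us ! i) Q (us ! (i + 1)) \<longrightarrow> read_once subdiv Q)"
  proof (cases "p = []")
    case True
    \<comment> \<open>The source is the sink, and it alone serves as the list with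
      \<open>a = 0\<close>.\<close>
    with p show ?thesis
      by (intro exI[of _ "[source subdiv]"] exI[of _ 0]) (auto simp: ends awalk_simps)
  next
    case False
    let ?ys = "yardsticks p"
    let ?us = "V (source Z) # ?ys @ [V (sink Z)]" and ?a = "Suc (length ?ys)"
    \<comment> \<open>Every source-sink walk splits into \<open>d\<close> pieces, and a level is one
      less than a number of pieces. The chain then has at most \<open>d - 1\<close> inner
      yardsticks, hence at most \<open>d\<close> stretches.\<close>
    have "vert_level (sink Z) \<le> d - 1"
      using Z d unfolding smnbp_def apath_iff_awalk
      by (intro vert_level_le) (auto simp: splits_def)
    moreover have "begins_level (V (source Z)) (vert_level (source Z))"
      using s by (simp add: begins_level_def)
    note chain = yardsticks_chain[OF s p(1) this]
    ultimately have "?a \<le> d" using d by linarith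
    moreover have "\<forall>i < ?a. read_once_between (?us ! i) (?us ! Suc i)"
      using chain unfolding successively_conv_nth by auto
    then have "\<forall>i < ?a. \<forall>Q. path subdiv (?us ! i) Q (?us ! (i + 1)) \<longrightarrow> read_once subdiv Q"
      unfolding read_once_between_def sub.apath_iff_awalk by simp
    moreover have "subseq ?us (sub.awalk_verts (source subdiv) P)"
      using subseq_yardsticks[OF p(1) False] p(2) ends by simp
    ultimately show ?thesis
      by (intro exI[of _ ?us] exI[of _ ?a]) (simp add: ends nth_append)
  qed
qed

end

theorem theorem7:
  fixes d :: nat and Z :: "('v, 'e, 'x) branching_program"
  assumes "d \<ge> 1" and "smnbp d Z"
  shows "\<exists>Z' :: (nat, nat, 'x) branching_program.
    smnbp d Z' \<and> has_yardsticks d Z' \<and> same_function Z Z' \<and> num_edges Z' \<le> 3 * num_edges Z"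
proof -
  have nbp: "nbp Z" using assms(2) unfolding smnbp_def monotone_nbp_def by blast
  then interpret fin_digraph "graph Z" unfolding nbp_def by blast
  \<comment> \<open>Finiteness lets vertices and arcs of any type be numbered, so that the new
    program lives on natural numbers.\<close>
  obtain \<phi> :: "'v \<Rightarrow> nat" where "inj_on \<phi> (verts (graph Z))"
    using finite_imp_inj_to_nat_seg[OF finite_verts] by blast
  moreover obtain \<psi> :: "'e \<Rightarrow> nat" where "inj_on \<psi> (arcs (graph Z))"
    using finite_imp_inj_to_nat_seg[OF finite_arcs] by blast
  ultimately interpret subdivision Z \<phi> \<psi>
    using nbp by unfold_locales (auto simp: nbp_def)
  show ?thesis
    using smnbp_subdiv[OF assms(2)] has_yardsticks_subdiv[OF assms(2,1)]
      same_function_subdiv[OF nbp] num_edges_subdiv by blast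
qed

end
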